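(* Let $n\in\mathbb{N}$. Let $X=\{x_1,\dots,x_m\}\subset\mathbb{T}^2$ be a finite node set and $w_1,\dots,w_m>0$ positive weights such that the quadrature formula $Q[f]=\sum_{j=1}^mw_jf(x_j)$ is exact for hyperbolic cross trigonometric polynomials of order $4n+3$, i.e. $Q[f]=\int_{\mathbb{T}^2}f(x)\,\mathrm{d}x$ for every $f$ of the form $f(x)=\sum_{k\in H_{4n+3}}c_k\,\mathrm{e}^{2\pi ik\cdot x}$ with $c_k\in\mathbb{C}$. Then the dispersion of $X$ satisfies $$\operatorname{disp}(X)=\sup_{[a_1,a_2)\times[b_1,b_2)\cap X=\emptyset}(a_2-a_1)(b_2-b_1)\le\frac{3}{n}.$$
   Context: $\mathbb{N}=\{1,2,\dots\}$. $\mathbb{T}^2\simeq[0,1)^2$ is the two-dimensional torus ($\mathbb{R}^2/\mathbb{Z}^2$, opposing sides identified) with normalized Lebesgue measure $\mathrm{d}x$. The hyperbolic cross of order $N$ is $H_N=\{(k_1,k_2)\in\mathbb{Z}^2:(1+|k_1|)(1+|k_2|)\le N+1\}$. The dispersion is the maximal volume of an empty axis-parallel box; the supremum is over boxes $[a_1,a_2)\times[b_1,b_2)$ in $\mathbb{T}^2$ (with $a_1<a_2\le a_1+1$, $b_1<b_2\le b_1+1$, regarded modulo $1$ in each coordinate) containing no point of $X$. *)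

theory Defs
  imports "HOL-Analysis.Analysis"
begin

text \<open>
  The two-dimensional torus is represented by its fundamental domain; a point of the plane
  is regarded as a point of the torus by reducing both coordinates modulo 1.
\<close>

definition torus2 :: "(real \<times> real) set" where
  "torus2 = {0..<1} \<times> {0..<1}"

definition to_torus2 :: "real \<times> real \<Rightarrow> real \<times> real" where
  "to_torus2 p = (frac (fst p), frac (snd p))"

definition hyperbolic_cross :: "nat \<Rightarrow> (int \<times> int) set" where
  "hyperbolic_cross N = {(k1, k2). (1 + \<bar>k1\<bar>) * (1 + \<bar>k2\<bar>) \<le> int N + 1}"

lemma finite_hyperbolic_cross: "finite (hyperbolic_cross N)"
proof -
  have "hyperbolic_cross N \<subseteq> {- int N..int N} \<times> {- int N..int N}"
  proof
    fix k assume "k \<in> hyperbolic_cross N"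
    then obtain k1 k2 where k: "k = (k1, k2)" "(1 + \<bar>k1\<bar>) * (1 + \<bar>k2\<bar>) \<le> int N + 1"
      by (auto simp: hyperbolic_cross_def)
    have "(1 + \<bar>k1\<bar>) * (1 + \<bar>k2\<bar>) = 1 + \<bar>k1\<bar> + \<bar>k2\<bar> + \<bar>k1\<bar> * \<bar>k2\<bar>"
      by (simp add: algebra_simps)
    moreover have "0 \<le> \<bar>k1\<bar> * \<bar>k2\<bar>" by simp
    ultimately have "\<bar>k1\<bar> \<le> int N" "\<bar>k2\<bar> \<le> int N" using k(2) by linarith+
    then show "k \<in> {- int N..int N} \<times> {- int N..int N}" by (auto simp: k(1))
  qed
  then show ?thesis by (rule finite_subset) simp
qed

definition trig_monomial :: "int \<times> int \<Rightarrow> real \<times> real \<Rightarrow> complex" where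
  "trig_monomial k x =
     exp (2 * of_real pi * \<i> * of_real (of_int (fst k) * fst x + of_int (snd k) * snd x))"

definition hyperbolic_cross_polys :: "nat \<Rightarrow> (real \<times> real \<Rightarrow> complex) set" where
  "hyperbolic_cross_polys N =
     {f. \<exists>c :: int \<times> int \<Rightarrow> complex. f = (\<lambda>x. \<Sum>k\<in>hyperbolic_cross N. c k * trig_monomial k x)}"

definition quadrature ::
  "nat \<Rightarrow> (nat \<Rightarrow> real \<times> real) \<Rightarrow> (nat \<Rightarrow> real) \<Rightarrow> (real \<times> real \<Rightarrow> complex) \<Rightarrow> complex" where
  "quadrature m x w f = (\<Sum>j=1..m. of_real (w j) * f (x j))"

text \<open>
  The factors of the box may wrap around 1; since the side lengths below are at most 1,
  the projection to the torus is injective on the box.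
\<close>

definition torus_box :: "real \<Rightarrow> real \<Rightarrow> real \<Rightarrow> real \<Rightarrow> (real \<times> real) set" where
  "torus_box a1 a2 b1 b2 = to_torus2 ` ({a1..<a2} \<times> {b1..<b2})"

definition empty_box_volumes :: "(real \<times> real) set \<Rightarrow> real set" where
  "empty_box_volumes X =
     {(a2 - a1) * (b2 - b1) | a1 a2 b1 b2.
        a1 < a2 \<and> a2 \<le> a1 + 1 \<and> b1 < b2 \<and> b2 \<le> b1 + 1 \<and> torus_box a1 a2 b1 b2 \<inter> X = {}}"

text \<open>
  The supremum of reals is meaningful for finite sets of points: it is then taken over a
  nonempty bounded set.
\<close>

definition dispersion :: "(real \<times> real) set \<Rightarrow> real" where
  "dispersion X = Sup (empty_box_volumes X)"

lemma bdd_above_empty_box_volumes: "bdd_above (empty_box_volumes X)"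
proof (rule bdd_aboveI)
  fix v assume "v \<in> empty_box_volumes X"
  then obtain a1 a2 b1 b2 where "v = (a2 - a1) * (b2 - b1)"
    "a1 < a2" "a2 \<le> a1 + 1" "b1 < b2" "b2 \<le> b1 + 1"
    by (auto simp: empty_box_volumes_def)
  then show "v \<le> 1" using mult_le_one[of "a2 - a1" "b2 - b1"] by simp
qed

lemma empty_box_volumes_nonempty:
  assumes "finite X"
  shows "empty_box_volumes X \<noteq> {}"
proof -
  have "infinite {0<..<1::real}" by (simp add: infinite_Ioo)
  then have "{0<..<1} - fst ` X \<noteq> {}"
    using assms by (metis Diff_eq_empty_iff finite_imageI finite_subset)
  then obtain a where a: "a \<in> {0<..<1} - fst ` X" by blast
  have "open ({0<..<1} - fst ` X)"
    using assms by (intro open_Diff finite_imp_closed) auto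
  with a obtain e where e: "e > 0" "ball a e \<subseteq> {0<..<1} - fst ` X"
    using open_contains_ball by blast
  define d where "d = min e 1"
  have fr: "frac s = s \<and> s \<notin> fst ` X" if "s \<in> {a..<a + d}" for s
  proof -
    have "s \<in> ball a e" using that by (auto simp: d_def dist_real_def)
    then show ?thesis using e(2) by (auto simp: frac_eq)
  qed
  have "torus_box a (a + d) 0 1 \<inter> X = {}"
  proof (rule ccontr)
    assume "torus_box a (a + d) 0 1 \<inter> X \<noteq> {}"
    then obtain p where p: "p \<in> {a..<a + d} \<times> {0..<1}" "to_torus2 p \<in> X"
      unfolding torus_box_def by blast
    define s where "s = fst p"
    define t where "t = snd p"
    have "s \<in> {a..<a + d}" using p(1) unfolding s_def by (simp add: mem_Times_iff)
    moreover have "(frac s, frac t) \<in> X"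
      using p(2) unfolding s_def t_def to_torus2_def .
    ultimately show False using fr[of s] by (metis fst_conv image_eqI)
  qed
  then have "(a + d - a) * (1 - 0) \<in> empty_box_volumes X"
    unfolding empty_box_volumes_def using e(1)
    by (intro CollectI exI[of _ a] exI[of _ "a + d"] exI[of _ 0] exI[of _ 1]) (auto simp: d_def)
  then show ?thesis by blast
qed

end

(* Suppose a box with centre (a,b) and sides A, B contains no node and A B > 3/n. The function
     h(s,t) = 1 - (1 - cos 2pi(s-a)) / (1 - cos pi A) - (1 - cos 2pi(t-b)) / (1 - cos pi B)
   is nonpositive off the box, so Q[u v h] <= 0 for all nonnegative u(s), v(t). Let u, v be the
   nonnegative trigonometric polynomials of degrees M - 2 and L - 2 most concentrated at a and b
   in the sense that the quotient of the integrals of u(s) cos 2pi(s-a) and of u is cos(pi/M),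
   respectively cos(pi/L) for v. Then the integral of u v h has the sign of
     1 - (1 - cos(pi/M)) / (1 - cos pi A) - (1 - cos(pi/L)) / (1 - cos pi B).
   If M L <= 4n + 4, then u v h is a hyperbolic cross polynomial of order 4n + 3, and since
   A B > 3/n, M and L can be chosen with A M >= 2 and B L >= 3, which makes this expression at
   least 1 - pi^2/16 - pi^2/36 > 0, a contradiction. *)

theory Submission
  imports Defs
begin

section \<open>Integrals of the trigonometric monomials\<close>

lemma set_integral_cis:
  "(LINT t:{0..<1}|lborel. cis (2 * pi * (of_int k * t))) = (if k = 0 then 1 else 0)"
proof -
  let ?f = "\<lambda>t. cis (2 * pi * (of_int k * t))"
  have cont: "continuous_on S ?f" for S
    by (intro continuous_intros)
  have meas: "?f \<in> borel_measurable borel"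
    by (intro borel_measurable_continuous_onI cont)
  \<comment> \<open>Dropping the endpoint 1 changes the integral by nothing, and the fundamental
    theorem of calculus wants the closed interval.\<close>
  have "AE t in lborel. t \<noteq> (1::real)"
    by (rule AE_lborel_singleton)
  then have "AE t in lborel. t \<in> {0..1} \<longleftrightarrow> t \<in> {0..<1::real}"
    by eventually_elim auto
  then have "(LINT t:{0..<1}|lborel. ?f t) = (LINT t:{0..1}|lborel. ?f t)"
    by (intro set_integral_cong_set)
      (use meas in \<open>auto simp: set_borel_measurable_def\<close>)
  also have "\<dots> = (if k = 0 then 1 else 0)"
  proof (cases "k = 0")
    case True
    then show ?thesis by (simp add: set_lebesgue_integral_def)
  next
    case False
    define F where "F = (\<lambda>t. cis (2 * pi * (of_int k * t)) / (2 * pi * \<i> * of_int k))"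
    have "(F has_vector_derivative ?f t) (at t within {0..1})" for t
      unfolding F_def using False
      by (auto intro!: derivative_eq_intros has_vector_derivative_real_field
          simp: cis_conv_exp has_vector_derivative_complex_iff field_simps)
    then have "(LINT t|lborel. indicator {0..1} t *\<^sub>R ?f t) = F 1 - F 0"
      by (intro integral_FTC_atLeastAtMost) (use cont in auto)
    moreover have "F 1 = F 0"
      using cis_multiple_2pi[of "of_int k"] by (simp add: F_def)
    ultimately show ?thesis using False by (simp add: set_lebesgue_integral_def)
  qed
  finally show ?thesis .
qed

lemma trig_monomial_eq_cis:
  "trig_monomial k y
     = cis (2 * pi * (of_int (fst k) * fst y)) * cis (2 * pi * (of_int (snd k) * snd y))"
  by (simp add: trig_monomial_def cis_conv_exp exp_add[symmetric] algebra_simps)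

lemma norm_trig_monomial: "norm (trig_monomial k y) = 1"
  by (simp add: trig_monomial_eq_cis norm_mult)

text \<open>By Fubini, since the indicator of the square and the monomial both split into a factor
  for each coordinate.\<close>

lemma set_integral_trig_monomial:
  "(LINT y:torus2|lborel. trig_monomial k y) = (if k = 0 then 1 else 0)"
proof -
  define g where
    "g = (\<lambda>(l::int) t. indicator {0..<1} t *\<^sub>R cis (2 * pi * (of_int l * t)))"
  define h where "h = (\<lambda>y. indicator torus2 y *\<^sub>R trig_monomial k y)"
  have h_eq: "h (s, t) = g (fst k) s * g (snd k) t" for s t
    by (simp add: h_def g_def torus2_def indicator_times trig_monomial_eq_cis)
  have "trig_monomial k \<in> borel_measurable borel"
    unfolding trig_monomial_def
    by (intro borel_measurable_continuous_onI continuous_intros)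
  moreover have "torus2 \<in> sets borel"
    unfolding torus2_def by (intro borel_Times) auto
  moreover have "emeasure lborel torus2 < \<infinity>"
    unfolding torus2_def by (intro emeasure_bounded_finite bounded_Times) auto
  ultimately have "integrable lborel h"
    unfolding h_def
    by (intro integrableI_bounded_set_indicator[where B = 1])
      (auto simp: norm_trig_monomial)
  then have "(LINT y|lborel. h y) = (LINT s|lborel. LINT t|lborel. h (s, t))"
    using lborel_pair.integral_fst'[of h] by (simp add: lborel_prod)
  also have "\<dots> = (LINT s|lborel. g (fst k) s) * (LINT t|lborel. g (snd k) t)"
    by (simp add: h_eq)
  also have "\<dots> = (if k = 0 then 1 else 0)"
    using set_integral_cis[of "fst k"] set_integral_cis[of "snd k"]
    by (auto simp: g_def set_lebesgue_integral_def prod_eq_iff)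
  finally show ?thesis by (simp add: h_def set_lebesgue_integral_def)
qed

section \<open>Univariate trigonometric polynomials\<close>

text \<open>\<open>u\<close> is a trigonometric polynomial of degree at most \<open>N\<close> with constant coefficient \<open>\<alpha>\<close>.
  Carrying the coefficient along avoids integrating the polynomials: exactness is only
  ever applied to monomials.\<close>

definition has_trig_mean :: "nat \<Rightarrow> (real \<Rightarrow> complex) \<Rightarrow> complex \<Rightarrow> bool" where
  "has_trig_mean N u \<alpha> \<longleftrightarrow>
     (\<exists>a. (\<forall>t. u t = (\<Sum>k\<in>{- int N..int N}. a k * cis (2 * pi * (of_int k * t)))) \<and> a 0 = \<alpha>)"

text \<open>The shift by \<open>c\<close> multiplies the coefficient by a number of modulus 1, and
  this number is 1 when \<open>p = 0\<close>.\<close>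

lemma has_trig_mean_cis:
  assumes "\<bar>p\<bar> \<le> int N"
  shows "has_trig_mean N (\<lambda>t. z * cis (2 * pi * (of_int p * (t - c)))) (if p = 0 then z else 0)"
  unfolding has_trig_mean_def
proof (intro exI conjI allI)
  let ?a = "\<lambda>k. if k = p then z * cis (- (2 * pi * (of_int p * c))) else 0"
  show "z * cis (2 * pi * (of_int p * (t - c)))
      = (\<Sum>k\<in>{- int N..int N}. ?a k * cis (2 * pi * (of_int k * t)))" for t
  proof -
    have "(\<Sum>k\<in>{- int N..int N}. ?a k * cis (2 * pi * (of_int k * t)))
        = (\<Sum>k\<in>{- int N..int N}. if k = p then z * cis (- (2 * pi * (of_int p * c)))
             * cis (2 * pi * (of_int p * t)) else 0)"
      by (intro sum.cong) auto
    also have "\<dots> = z * cis (2 * pi * (of_int p * (t - c)))"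
      using assms by (auto simp: cis_mult algebra_simps)
    finally show ?thesis by simp
  qed
  show "?a 0 = (if p = 0 then z else 0)" by auto
qed

lemma has_trig_mean_add:
  assumes "has_trig_mean N u \<alpha>" "has_trig_mean N v \<beta>"
  shows "has_trig_mean N (\<lambda>t. u t + v t) (\<alpha> + \<beta>)"
proof -
  obtain a b where "\<forall>t. u t = (\<Sum>k\<in>{- int N..int N}. a k * cis (2 * pi * (of_int k * t)))"
    "a 0 = \<alpha>" "\<forall>t. v t = (\<Sum>k\<in>{- int N..int N}. b k * cis (2 * pi * (of_int k * t)))" "b 0 = \<beta>"
    using assms unfolding has_trig_mean_def by blast
  then show ?thesis unfolding has_trig_mean_def
    by (intro exI[of _ "\<lambda>k. a k + b k"]) (simp add: sum.distrib distrib_right)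
qed

lemma has_trig_mean_sum:
  assumes "\<And>i. i \<in> I \<Longrightarrow> has_trig_mean N (u i) (\<alpha> i)"
  shows "has_trig_mean N (\<lambda>t. \<Sum>i\<in>I. u i t) (\<Sum>i\<in>I. \<alpha> i)"
proof (cases "finite I")
  case True
  then show ?thesis using assms
  proof (induction I)
    case empty
    then show ?case using has_trig_mean_cis[of 0 N 0 0] by simp
  next
    case (insert i I)
    then show ?case by (simp add: has_trig_mean_add)
  qed
next
  case False
  then show ?thesis using has_trig_mean_cis[of 0 N 0 0] by simp
qed

lemma has_trig_mean_cmult:
  assumes "has_trig_mean N u \<alpha>"
  shows "has_trig_mean N (\<lambda>t. z * u t) (z * \<alpha>)"
proof -
  obtain a where "\<forall>t. u t = (\<Sum>k\<in>{- int N..int N}. a k * cis (2 * pi * (of_int k * t)))" "a 0 = \<alpha>"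
    using assms unfolding has_trig_mean_def by blast
  then show ?thesis unfolding has_trig_mean_def
    by (intro exI[of _ "\<lambda>k. z * a k"]) (simp add: sum_distrib_left mult.assoc)
qed

section \<open>The extremal nonnegative kernel\<close>

text \<open>The kernel is the squared modulus of a polynomial with frequencies 1 to M - 1 about
  \<open>c\<close>, so its degree is at most M - 2; the cosine factor raises this to M - 1. Its
  coefficients are chosen positive and such that averaging the two neighbours multiplies each by
  cos(pi/M).\<close>

lemma ex_nonneg_kernel:
  fixes c :: real
  assumes "M \<ge> 2"
  shows "\<exists>u S. (\<forall>t. u t \<ge> 0) \<and> S > 0 \<and>
    has_trig_mean (M - 1) (\<lambda>t. of_real (u t)) (of_real S) \<and>
    has_trig_mean (M - 1) (\<lambda>t. of_real (u t * cos (2 * pi * (t - c))))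
      (of_real (cos (pi / M) * S))"
proof -
  define I where "I = {1..<int M}"
  define s where "s = (\<lambda>k::int. sin (pi * k / M))"
  define e where "e = (\<lambda>(k::int) t. cis (2 * pi * (of_int k * (t - c))))"
  define u where "u = (\<lambda>t. (cmod (\<Sum>k\<in>I. s k * e k t))\<^sup>2)"
  define S where "S = (\<Sum>k\<in>I. (s k)\<^sup>2)"
  have fin: "finite I" by (simp add: I_def)
  have e_mult: "e k t * e l t = e (k + l) t" for k l t
    by (simp add: e_def cis_mult algebra_simps)
  have u_eq: "of_real (u t) = (\<Sum>j\<in>I. \<Sum>k\<in>I. of_real (s j * s k) * e (j - k) t)" for t
  proof -
    have "of_real (u t) = (\<Sum>j\<in>I. s j * e j t) * (\<Sum>k\<in>I. s k * e (- k) t)"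
      unfolding u_def complex_norm_square
      by (simp add: cnj_sum e_def cis_cnj)
    also have "\<dots> = (\<Sum>j\<in>I. \<Sum>k\<in>I. s j * s k * (e j t * e (- k) t))"
      by (simp add: sum_product algebra_simps)
    finally show ?thesis by (simp add: e_mult)
  qed
  have cos_eq: "of_real (cos (2 * pi * (t - c))) = (e 1 t + e (- 1) t) / 2" for t
  proof -
    have "e (- 1) t = cis (- (2 * pi * (t - c)))" by (simp add: e_def algebra_simps)
    then show ?thesis by (simp add: e_def complex_eq_iff)
  qed
  \<comment> \<open>Multiplying by \<open>e d\<close> turns the frequency \<open>j - k\<close> into
    \<open>j - k + d\<close>, so the constant coefficient collects the pairs with
    \<open>k = j + d\<close>. The case \<open>d = 0\<close> gives \<open>u\<close>, the cases 1 and
    -1 give the cosine.\<close>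
  have shift: "has_trig_mean (M - 1) (\<lambda>t. of_real (u t) * e d t)
      (\<Sum>j\<in>I. \<Sum>k\<in>I. if k = j + d then of_real (s j * s k) else 0)" if "\<bar>d\<bar> \<le> 1" for d
  proof -
    have "has_trig_mean (M - 1) (\<lambda>t. of_real (s j * s k) * e (j - k + d) t)
        (if k = j + d then of_real (s j * s k) else 0)" if "j \<in> I" "k \<in> I" for j k
    proof -
      have "\<bar>j - k + d\<bar> \<le> int (M - 1)"
        using that \<open>\<bar>d\<bar> \<le> 1\<close> by (auto simp: I_def)
      moreover have "k = j + d \<longleftrightarrow> j - k + d = 0" by auto
      ultimately show ?thesis by (simp only: e_def has_trig_mean_cis)
    qed
    then have "has_trig_mean (M - 1) (\<lambda>t. \<Sum>j\<in>I. \<Sum>k\<in>I. of_real (s j * s k) * e (j - k + d) t)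
        (\<Sum>j\<in>I. \<Sum>k\<in>I. if k = j + d then of_real (s j * s k) else 0)"
      by (intro has_trig_mean_sum) auto
    moreover have "(\<lambda>t. \<Sum>j\<in>I. \<Sum>k\<in>I. of_real (s j * s k) * e (j - k + d) t)
        = (\<lambda>t. of_real (u t) * e d t)"
      by (simp add: u_eq sum_distrib_right mult.assoc e_mult)
    ultimately show ?thesis by simp
  qed
  \<comment> \<open>From \<open>I\<close> a step of length one can lead out only to 0 or
    \<open>M\<close>. As the sine vanishes there, cutting the sum off at \<open>I\<close> loses
    nothing.\<close>
  have s_outside: "s k = 0" if "k \<in> {0, int M}" for k
    using that assms by (auto simp: s_def)
  have mean: "(\<Sum>j\<in>I. \<Sum>k\<in>I. if k = j + d then complex_of_real (s j * s k) else 0)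
      = of_real (\<Sum>j\<in>I. s j * s (j + d))" if "\<bar>d\<bar> \<le> 1" for d
  proof -
    have "(\<Sum>k\<in>I. if k = j + d then complex_of_real (s j * s k) else 0) = of_real (s j * s (j + d))"
      if "j \<in> I" for j
    proof (cases "j + d \<in> I")
      case True
      then show ?thesis using fin by simp
    next
      case False
      then have "j + d \<in> {0, int M}"
        using \<open>j \<in> I\<close> \<open>\<bar>d\<bar> \<le> 1\<close> by (auto simp: I_def)
      then show ?thesis using False fin s_outside by simp
    qed
    then show ?thesis by simp
  qed
  have mean_u: "has_trig_mean (M - 1) (\<lambda>t. of_real (u t)) (of_real S)"
    using shift[of 0] mean[of 0] by (simp add: S_def power2_eq_square e_def)
  \<comment> \<open>The coefficients \<open>s\<close> form an eigenvector of the adjacency matrix of a path.\<close>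
  have recurrence: "s (j + 1) + s (j - 1) = 2 * cos (pi / M) * s j" for j
    by (simp add: s_def add_divide_distrib diff_divide_distrib distrib_left right_diff_distrib
        sin_add sin_diff)
  have "has_trig_mean (M - 1)
      (\<lambda>t. 1 / 2 * (of_real (u t) * e 1 t + of_real (u t) * e (- 1) t))
      (1 / 2 * (of_real (\<Sum>j\<in>I. s j * s (j + 1)) + of_real (\<Sum>j\<in>I. s j * s (j + - 1))))"
    using shift[of 1] shift[of "- 1"] mean[of 1] mean[of "- 1"]
    by (intro has_trig_mean_cmult has_trig_mean_add) (simp_all only: abs_minus_cancel abs_one order_refl)
  also have "(\<lambda>t. 1 / 2 * (of_real (u t) * e 1 t + of_real (u t) * e (- 1) t))
      = (\<lambda>t. of_real (u t * cos (2 * pi * (t - c))))"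
    unfolding of_real_mult cos_eq by (simp add: distrib_left add_divide_distrib)
  also have "1 / 2 * (of_real (\<Sum>j\<in>I. s j * s (j + 1)) + of_real (\<Sum>j\<in>I. s j * s (j + - 1)))
      = complex_of_real (1 / 2 * (\<Sum>j\<in>I. s j * (s (j + 1) + s (j - 1))))"
    by (simp add: sum.distrib distrib_left)
  also have "\<dots> = of_real (cos (pi / M) * S)"
    unfolding recurrence S_def by (simp add: sum_distrib_left power2_eq_square mult_ac)
  finally have mean_cos: "has_trig_mean (M - 1) (\<lambda>t. of_real (u t * cos (2 * pi * (t - c))))
      (of_real (cos (pi / M) * S))" .
  have "0 < s k" if "k \<in> I" for k
    unfolding s_def using that by (intro sin_gt_zero) (auto simp: I_def field_simps)
  then have "S > 0"
    unfolding S_def using assms fin by (intro sum_pos zero_less_power) (auto simp: I_def)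
  then show ?thesis
    using mean_u mean_cos by (intro exI[of _ u] exI[of _ S]) (auto simp: u_def)
qed

section \<open>Quadrature of tensor products\<close>

text \<open>The integral enters only here; everything later uses the formula through its values on
  monomials.\<close>

lemma quadrature_trig_monomial:
  assumes exact: "\<And>f. f \<in> hyperbolic_cross_polys N \<Longrightarrow>
      quadrature m x w f = (LINT y:torus2|lborel. f y)"
    and k: "k \<in> hyperbolic_cross N"
  shows "quadrature m x w (trig_monomial k) = (if k = 0 then 1 else 0)"
proof -
  have "trig_monomial k y
      = (\<Sum>l\<in>hyperbolic_cross N. (if l = k then 1 else 0) * trig_monomial l y)" for y
  proof -
    have "(\<Sum>l\<in>hyperbolic_cross N. (if l = k then 1 else 0) * trig_monomial l y)
        = (\<Sum>l\<in>hyperbolic_cross N. if l = k then trig_monomial k y else 0)"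
      by (intro sum.cong) auto
    then show ?thesis using k finite_hyperbolic_cross by simp
  qed
  then have "trig_monomial k \<in> hyperbolic_cross_polys N"
    unfolding hyperbolic_cross_polys_def by (intro CollectI exI ext)
  then show ?thesis by (simp add: exact set_integral_trig_monomial)
qed

text \<open>The frequencies fill a rectangle on which (1 + |k|)(1 + |l|) is largest at the corners,
  so \<open>pq\<close> puts all of it into the hyperbolic cross. Exactness then leaves only the
  frequency zero.\<close>

lemma quadrature_tensor:
  assumes exact: "\<And>k. k \<in> hyperbolic_cross N \<Longrightarrow>
      quadrature m x w (trig_monomial k) = (if k = 0 then 1 else 0)"
    and u: "has_trig_mean p u \<alpha>" and v: "has_trig_mean q v \<beta>"
    and pq: "(p + 1) * (q + 1) \<le> N + 1"
  shows "(\<Sum>j=1..m. of_real (w j) * (u (fst (x j)) * v (snd (x j)))) = \<alpha> * \<beta>"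
proof -
  let ?K = "{- int p..int p}" and ?L = "{- int q..int q}"
  obtain a b where
    a: "\<And>t. u t = (\<Sum>k\<in>?K. a k * cis (2 * pi * (of_int k * t)))" "a 0 = \<alpha>" and
    b: "\<And>t. v t = (\<Sum>l\<in>?L. b l * cis (2 * pi * (of_int l * t)))" "b 0 = \<beta>"
    using u v unfolding has_trig_mean_def by blast
  have cross: "(k, l) \<in> hyperbolic_cross N" if "k \<in> ?K" "l \<in> ?L" for k l
  proof -
    have "(1 + \<bar>k\<bar>) * (1 + \<bar>l\<bar>) \<le> (int p + 1) * (int q + 1)"
      using that by (intro mult_mono) auto
    also have "\<dots> = int ((p + 1) * (q + 1))" by (simp add: algebra_simps)
    also have "\<dots> \<le> int (N + 1)" using pq by (simp only: of_nat_le_iff)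
    finally show ?thesis by (simp add: hyperbolic_cross_def)
  qed
  have "u (fst y) * v (snd y) = (\<Sum>k\<in>?K. \<Sum>l\<in>?L. a k * b l * trig_monomial (k, l) y)" for y
    by (simp add: a b sum_product trig_monomial_eq_cis mult_ac)
  then have "(\<Sum>j=1..m. of_real (w j) * (u (fst (x j)) * v (snd (x j))))
      = (\<Sum>j=1..m. \<Sum>k\<in>?K. \<Sum>l\<in>?L. a k * b l * (of_real (w j) * trig_monomial (k, l) (x j)))"
    by (simp add: sum_distrib_left mult_ac)
  also have "\<dots> = (\<Sum>k\<in>?K. \<Sum>l\<in>?L. \<Sum>j=1..m. a k * b l * (of_real (w j) * trig_monomial (k, l) (x j)))"
    by (subst sum.swap, rule sum.cong[OF refl], rule sum.swap)
  also have "\<dots> = (\<Sum>k\<in>?K. \<Sum>l\<in>?L. a k * b l * quadrature m x w (trig_monomial (k, l)))"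
    by (simp add: quadrature_def sum_distrib_left)
  also have "\<dots> = (\<Sum>k\<in>?K. \<Sum>l\<in>?L. if l = 0 then if k = 0 then a 0 * b 0 else 0 else 0)"
    by (intro sum.cong refl) (auto simp: exact[OF cross] zero_prod_def)
  also have "\<dots> = \<alpha> * \<beta>" by (simp add: a(2) b(2))
  finally show ?thesis .
qed

section \<open>Empty boxes\<close>

lemma one_minus_cos_le: "1 - cos t \<le> t\<^sup>2 / 2" for t :: real
proof -
  have "(sin (t / 2))\<^sup>2 \<le> (t / 2)\<^sup>2"
    using abs_sin_x_le_abs_x[of "t / 2"] by (simp only: abs_le_square_iff)
  then show ?thesis using cos_double_sin[of "t / 2"] by (simp add: power_divide)
qed

text \<open>Concavity of the sine gives Jordan's inequality \<open>A \<le> sin (pi * A / 2)\<close>,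
  which is squared in the half-angle formula.\<close>

lemma le_one_minus_cos:
  assumes "0 \<le> A" "A \<le> 1"
  shows "2 * A\<^sup>2 \<le> 1 - cos (pi * A)"
proof -
  have "convex_on {0..pi / 2} (\<lambda>t. - sin t)"
    by (rule f''_ge0_imp_convex[where f' = "\<lambda>t. - cos t" and f'' = sin])
      (auto intro!: derivative_eq_intros sin_ge_zero)
  from convex_onD[OF this, of A 0 "pi / 2"] have "A \<le> sin (pi * A / 2)"
    using assms by (simp add: mult.commute)
  then have "A\<^sup>2 \<le> (sin (pi * A / 2))\<^sup>2"
    using assms by (intro power_mono)
  then show ?thesis using cos_double_sin[of "pi * A / 2"] by simp
qed

text \<open>The cosine depends only on the circular distance from \<open>s\<close> to the centre and
  decreases with it, so this distance is below half the side. Subtracting the nearest integer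
  \<open>z\<close> moves \<open>s\<close> to its representative in the interval.\<close>

lemma frac_mem_of_cos:
  assumes "a1 < a2" "a2 \<le> a1 + 1" "0 \<le> s" "s < 1"
    and cos: "cos (2 * pi * (s - (a1 + a2) / 2)) > cos (pi * (a2 - a1))"
  shows "\<exists>t\<in>{a1..<a2}. frac t = s"
proof -
  define r where "r = s - (a1 + a2) / 2"
  define z where "z = round r"
  have z: "\<bar>r - z\<bar> \<le> 1 / 2"
    unfolding z_def using of_int_round_abs_le[of r] by (simp add: abs_minus_commute)
  have "2 * pi * r = 2 * pi * (r - z) + 2 * pi * of_int z" by (simp add: algebra_simps)
  then have "cos (2 * pi * r) = cos (2 * pi * (r - z))"
    by (simp only: cos_add) (simp add: cos_int_2pin sin_int_2pin)
  also have "\<dots> = cos \<bar>2 * pi * (r - z)\<bar>" by simp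
  also have "\<dots> = cos (2 * pi * \<bar>r - z\<bar>)" by (simp only: abs_mult) simp
  finally have "cos (pi * (a2 - a1)) < cos (2 * pi * \<bar>r - z\<bar>)"
    using cos by (simp add: r_def)
  moreover have "2 * pi * \<bar>r - z\<bar> \<le> pi" using z by simp
  moreover have "pi * (a2 - a1) \<le> pi" using assms by simp
  ultimately have "2 * pi * \<bar>r - z\<bar> < pi * (a2 - a1)"
    using assms cos_mono_less_eq[of "pi * (a2 - a1)" "2 * pi * \<bar>r - z\<bar>"] by simp
  then have "\<bar>r - z\<bar> < (a2 - a1) / 2" by simp
  then have "s - z \<in> {a1..<a2}" by (auto simp: r_def abs_less_iff field_simps)
  moreover have "frac (s - z) = s"
    using assms by (simp add: frac_unique_iff)
  ultimately show ?thesis by blast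
qed

text \<open>\<open>M\<close> is the least degree parameter with \<open>A * M \<ge> 2\<close>, and
  \<open>L\<close> is the largest one that the budget 4n + 4 then allows.\<close>

lemma degree_choice:
  fixes A B :: real
  assumes "n \<ge> 1" "0 < A" "A \<le> 1" "0 < B" "B \<le> 1" "A * B > 3 / real n"
  shows "\<exists>M L :: nat. M \<ge> 2 \<and> L \<ge> 2 \<and> M * L \<le> 4 * n + 4 \<and> A * M \<ge> 2 \<and> B * L \<ge> 3"
proof -
  define M where "M = nat \<lceil>2 / A\<rceil>"
  define L where "L = (4 * n + 4) div M"
  have "2 / A \<ge> 2" using assms by (simp add: field_simps)
  then have M: "real M \<ge> 2 / A" "real M < 2 / A + 1" "real M \<ge> 2"
    unfolding M_def by linarith+
  \<comment> \<open>Rounding up adds less than \<open>A\<close> to \<open>A * M\<close>, and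
    \<open>A \<le> 1\<close>.\<close>
  then have AM: "A * M \<ge> 2" "A * M \<le> 3" using assms by (simp_all add: field_simps)
  have "12 < 4 * n * (A * B)" using assms by (simp add: field_simps)
  also have "\<dots> \<le> (4 * n + 4) * (A * B)" using assms by (intro mult_right_mono) auto
  \<comment> \<open>Division with remainder gives 4n + 4 < (L + 1) M.\<close>
  also have "\<dots> < (real L * M + M) * (A * B)"
  proof (intro mult_strict_right_mono)
    have "4 * n + 4 < L * M + M"
      unfolding L_def using M(3) by (metis (no_types) add.commute dividend_less_div_times
          of_nat_0 not_numeral_le_zero of_nat_le_0_iff gr0I mult.commute)
    then show "real (4 * n + 4) < real L * real M + real M"
      by (metis of_nat_add of_nat_less_iff of_nat_mult)
  qed (use assms in auto)
  also have "\<dots> = (B * L + B) * (A * M)" by (simp add: algebra_simps)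
  also have "\<dots> \<le> (B * L + B) * 3" using AM assms by (intro mult_left_mono) auto
  \<comment> \<open>The chain yields \<open>B * L + B > 4\<close>, and
    \<open>B \<le> 1\<close>.\<close>
  finally have BL: "B * L > 3" using assms by simp
  moreover have "B * L \<le> L" using assms by (simp add: mult_left_le_one_le)
  ultimately have "L \<ge> 2" by linarith
  moreover have "M * L \<le> 4 * n + 4" by (simp add: L_def)
  ultimately show ?thesis using AM BL M(3) by (intro exI[of _ M] exI[of _ L]) auto
qed

text \<open>Both cosine bounds are quadratic, so only the product \<open>A * M\<close> matters. The
  values 2 and 3 of \<open>d\<close> give pi^2/16 and pi^2/36.\<close>

lemma kernel_ratio_le:
  fixes A :: real
  assumes "0 < A" "A \<le> 1" "0 < d" "d \<le> A * M"
  shows "(1 - cos (pi / M)) / (1 - cos (pi * A)) \<le> pi\<^sup>2 / (4 * d\<^sup>2)"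
proof -
  have "M > 0" using assms by (metis mult_pos_pos mult_nonneg_nonpos not_le less_le_trans less_imp_le)
  have "(1 - cos (pi / M)) / (1 - cos (pi * A)) \<le> ((pi / M)\<^sup>2 / 2) / (2 * A\<^sup>2)"
    using assms one_minus_cos_le[of "pi / M"] le_one_minus_cos[of A] by (intro frac_le) auto
  also have "\<dots> = pi\<^sup>2 / (4 * (A * M)\<^sup>2)" by (simp add: power_divide power_mult_distrib field_simps)
  also have "\<dots> \<le> pi\<^sup>2 / (4 * d\<^sup>2)"
    using assms \<open>M > 0\<close> by (intro divide_left_mono mult_left_mono power_mono mult_pos_pos) auto
  finally show ?thesis .
qed

lemma empty_box_area_le:
  fixes n m :: nat and x :: "nat \<Rightarrow> real \<times> real" and w :: "nat \<Rightarrow> real"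
  assumes n: "n \<ge> 1"
    and x: "\<And>j. j \<in> {1..m} \<Longrightarrow> x j \<in> torus2"
    and w: "\<And>j. j \<in> {1..m} \<Longrightarrow> w j > 0"
    and exact: "\<And>f. f \<in> hyperbolic_cross_polys (4 * n + 3) \<Longrightarrow>
           quadrature m x w f = (LINT y:torus2|lborel. f y)"
    and a: "a1 < a2" "a2 \<le> a1 + 1" and b: "b1 < b2" "b2 \<le> b1 + 1"
    and empty: "torus_box a1 a2 b1 b2 \<inter> x ` {1..m} = {}"
  shows "(a2 - a1) * (b2 - b1) \<le> 3 / real n"
proof (rule ccontr)
  define A where "A = a2 - a1"
  define B where "B = b2 - b1"
  assume "\<not> ?thesis"
  then have AB: "A * B > 3 / real n" by (simp add: A_def B_def)
  have A: "0 < A" "A \<le> 1" and B: "0 < B" "B \<le> 1" using a b by (auto simp: A_def B_def)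
  obtain M L :: nat where sz: "M \<ge> 2" "L \<ge> 2" "M * L \<le> 4 * n + 4" "A * M \<ge> 2" "B * L \<ge> 3"
    using degree_choice[OF n A B AB] by blast
  define c where "c = (\<lambda>s. cos (2 * pi * (s - (a1 + a2) / 2)))"
  define d where "d = (\<lambda>t. cos (2 * pi * (t - (b1 + b2) / 2)))"
  obtain u S where u: "\<And>s. u s \<ge> 0" "S > 0"
    "has_trig_mean (M - 1) (\<lambda>s. of_real (u s)) (of_real S)"
    "has_trig_mean (M - 1) (\<lambda>s. of_real (u s * c s)) (of_real (cos (pi / M) * S))"
    using ex_nonneg_kernel[OF sz(1), of "(a1 + a2) / 2"] unfolding c_def by blast
  obtain v T where v: "\<And>t. v t \<ge> 0" "T > 0"
    "has_trig_mean (L - 1) (\<lambda>t. of_real (v t)) (of_real T)"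
    "has_trig_mean (L - 1) (\<lambda>t. of_real (v t * d t)) (of_real (cos (pi / L) * T))"
    using ex_nonneg_kernel[OF sz(2), of "(b1 + b2) / 2"] unfolding d_def by blast
  \<comment> \<open>The left side is just \<open>M * L\<close>: the degrees M - 1 and L - 1 already
    include the cosine factors.\<close>
  have deg: "(M - 1 + 1) * (L - 1 + 1) \<le> 4 * n + 3 + 1" using sz by simp
  have tensor: "(\<Sum>j=1..m. w j * (f (fst (x j)) * g (snd (x j)))) = \<alpha> * \<beta>"
    if "has_trig_mean (M - 1) (\<lambda>s. of_real (f s)) (of_real \<alpha>)"
      "has_trig_mean (L - 1) (\<lambda>t. of_real (g t)) (of_real \<beta>)" for f g and \<alpha> \<beta> :: real
  proof -
    have "complex_of_real (\<Sum>j=1..m. w j * (f (fst (x j)) * g (snd (x j)))) = of_real (\<alpha> * \<beta>)"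
      using quadrature_tensor[OF quadrature_trig_monomial[OF exact] that deg] by simp
    then show ?thesis by (simp only: of_real_eq_iff)
  qed
  define p where "p = 1 / (1 - cos (pi * A))"
  define q where "q = 1 / (1 - cos (pi * B))"
  have pos: "1 - cos (pi * A) > 0" "1 - cos (pi * B) > 0"
    using le_one_minus_cos[of A] le_one_minus_cos[of B] A B
    by (smt (verit) zero_less_power)+
  define h where "h = (\<lambda>y. 1 - p * (1 - c (fst y)) - q * (1 - d (snd y)))"
  have "h (x j) \<le> 0" if j: "j \<in> {1..m}" for j
  proof -
    obtain s t where st: "x j = (s, t)" "0 \<le> s" "s < 1" "0 \<le> t" "t < 1"
      using x[OF j] by (cases "x j") (auto simp: torus2_def)
    \<comment> \<open>Were both cosines larger, both coordinates would lie in the sides of the box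
      modulo 1, against its emptiness.\<close>
    have "c s \<le> cos (pi * A) \<or> d t \<le> cos (pi * B)"
    proof (rule ccontr)
      assume "\<not> ?thesis"
      then obtain s' t' where "s' \<in> {a1..<a2}" "frac s' = s" "t' \<in> {b1..<b2}" "frac t' = t"
        using frac_mem_of_cos[OF a st(2,3)] frac_mem_of_cos[OF b st(4,5)]
        by (auto simp: not_le c_def d_def A_def B_def)
      then have "(s, t) \<in> torus_box a1 a2 b1 b2"
        unfolding torus_box_def to_torus2_def by (intro image_eqI[of _ _ "(s', t')"]) auto
      then show False using empty j st(1) by (metis IntI empty_iff imageI)
    qed
    moreover have "p * (1 - c s) \<ge> 0" "q * (1 - d t) \<ge> 0"
      using pos by (simp_all add: p_def q_def c_def d_def)
    \<comment> \<open>\<open>p\<close> and \<open>q\<close> are scaled so that a penalty reaches 1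
      where its cosine is at most the value at the edge of the box. One such penalty suffices, as
      the other is nonnegative.\<close>
    moreover have "p * (1 - c s) \<ge> 1" if "c s \<le> cos (pi * A)"
      using that pos by (simp add: p_def le_divide_eq)
    moreover have "q * (1 - d t) \<ge> 1" if "d t \<le> cos (pi * B)"
      using that pos by (simp add: q_def le_divide_eq)
    ultimately show ?thesis by (auto simp: h_def st(1))
  qed
  then have "(\<Sum>j=1..m. w j * (u (fst (x j)) * v (snd (x j)) * h (x j))) \<le> 0"
    using w u(1) v(1) by (intro sum_nonpos mult_nonneg_nonpos mult_nonneg_nonneg) (auto intro: less_imp_le)
  \<comment> \<open>\<open>h\<close> is affine in \<open>c\<close> and \<open>d\<close> without a
    mixed term, so three tensor products suffice, with at most one cosine in each.\<close>
  moreover have "(\<Sum>j=1..m. w j * (u (fst (x j)) * v (snd (x j)) * h (x j)))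
      = (1 - p - q) * (S * T) + p * (cos (pi / M) * S * T) + q * (S * (cos (pi / L) * T))"
    unfolding tensor[OF u(3) v(3), symmetric] tensor[OF u(4) v(3), symmetric]
      tensor[OF u(3) v(4), symmetric] sum_distrib_left sum.distrib[symmetric]
    by (intro sum.cong refl) (simp add: h_def algebra_simps)
  moreover have "\<dots> = S * T * (1 - (1 - cos (pi / M)) / (1 - cos (pi * A))
      - (1 - cos (pi / L)) / (1 - cos (pi * B)))"
    by (simp add: p_def q_def algebra_simps diff_divide_distrib)
  moreover have "(1 - cos (pi / M)) / (1 - cos (pi * A)) + (1 - cos (pi / L)) / (1 - cos (pi * B)) < 1"
  proof -
    \<comment> \<open>Coarse but enough: 10.24 (1/16 + 1/36) is about 0.92.\<close>
    have "pi\<^sup>2 < 3.2\<^sup>2" using pi_approx by (intro power_strict_mono) auto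
    then show ?thesis
      using kernel_ratio_le[OF A _ sz(4)] kernel_ratio_le[OF B _ sz(5)]
      by (simp add: power2_eq_square) argo
  qed
  ultimately show False
    using mult_pos_pos[OF u(2) v(2)] by (smt (verit) mult_pos_pos)
qed

theorem mainTheorem8:
  fixes n m :: nat and x :: "nat \<Rightarrow> real \<times> real" and w :: "nat \<Rightarrow> real"
  assumes "n \<ge> 1"
    and "\<And>j. j \<in> {1..m} \<Longrightarrow> x j \<in> torus2"
    and "\<And>j. j \<in> {1..m} \<Longrightarrow> w j > 0"
    and "\<And>f. f \<in> hyperbolic_cross_polys (4 * n + 3) \<Longrightarrow>
           quadrature m x w f = (LINT y:torus2|lborel. f y)"
  shows "dispersion (x ` {1..m}) \<le> 3 / real n"
  unfolding dispersion_def
proof (rule cSup_least)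
  \<comment> \<open>On the reals, a bound on all elements passes to \<open>Sup\<close> by
    \<open>cSup_least\<close> only for a nonempty set.\<close>
  show "empty_box_volumes (x ` {1..m}) \<noteq> {}"
    by (intro empty_box_volumes_nonempty) simp
  fix r assume "r \<in> empty_box_volumes (x ` {1..m})"
  then show "r \<le> 3 / real n"
    unfolding empty_box_volumes_def using empty_box_area_le[OF assms] by blast
qed

end
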